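(* Let $n\ge 1$, let $A_0\in\mathbb{R}^{q\times q}$, $B_0\in\mathbb{R}^{q\times m}$, $C_0\in\mathbb{R}^{p\times q}$, $D_0\in\mathbb{R}^{p\times m}$ be constant matrices, and let $\phi_i:\mathbb{R}^p\to\mathbb{R}^m$ be continuous (possibly nonlinear) functions for $i\in\{1,\dots,n\}$. Consider the centralized algorithm $$\xi_0^{k+1}=A_0\xi_0^k+B_0\,\mathsf{ave}(u^k),\qquad v_0^k=C_0\xi_0^k+D_0\,\mathsf{ave}(u^k),\qquad u_i^k=\phi_i(v_0^k),\quad i=1,\dots,n. \qquad (\mathrm{C})$$ Let $G_{\mathrm{con}}$ be a system that achieves average consensus tracking, and consider the decentralized algorithm $$\xi_i^{k+1}=A_0\xi_i^k+B_0\hat u_i^k,\qquad v_i^k=C_0\xi_i^k+D_0\hat u_i^k,\qquad u_i^k=\phi_i(\hat v_i^k),\quad i=1,\dots,n, \qquad (\mathrm{D})$$ where $\hat u=G_{\mathrm{con}}u$ and $\hat v=G_{\mathrm{con}}v$. If $\xi_0^\star\in\mathbb{R}^q$ is a possible steady-state value of $\xi_0$ in (C), then $\xi_0^\star$ is also a steady-state value of $\xi_i$ in (D), simultaneously for all $i\in\{1,\dots,n\}$ (that is, (D) has a steady state in which $\xi_1=\xi_2=\dots=\xi_n=\xi_0^\star$).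
   Context: Notation. For local vectors $x_1,\dots,x_n\in\mathbb{R}^r$, write $x=[x_1\ x_2\ \cdots\ x_n]^T\in\mathbb{R}^{n\times r}$ for the matrix whose $i$-th row is $x_i^T$ (so $u^k\in\mathbb{R}^{n\times m}$ has rows $(u_i^k)^T$, $v^k\in\mathbb{R}^{n\times p}$ has rows $(v_i^k)^T$, and similarly for $\hat u^k,\hat v^k$). Put $\mathsf{ave}(x)=\frac1n\sum_{i=1}^n x_i=\frac1n x^T\mathbf{1}\in\mathbb{R}^r$, where $\mathbf 1\in\mathbb{R}^n$ is the all-ones column vector, and $J=\mathbf{1}\mathbf{1}^T/n$; thus every row of $Jx$ equals $\mathsf{ave}(x)^T$. Superscripts $k\ge 0$ index time. Average consensus tracking. A (discrete-time) dynamical system $G_{\mathrm{con}}$, mapping sequences $\{s^k\in\mathbb{R}^{n\times r}\}_{k\ge0}$ to sequences in $\mathbb{R}^{n\times r}$ (used for $r=m$ and $r=p$), achieves average consensus tracking if for every input sequence $s=\{s^k\}$ converging to some $s^\star$, the output sequence $G_{\mathrm{con}}s$ converges to $Js^\star$. Accordingly, the steady-state value of the output of $G_{\mathrm{con}}$ corresponding to a steady-state value $s^\star$ of its input is $Js^\star$. Steady states. A steady state of an algorithm is a collection of constant values of its variables that satisfies all of the algorithm's equations in steady state (when every variable is set to its steady-state value at all times $k$), with each $G_{\mathrm{con}}$ block relating the steady-state value of its input to the corresponding steady-state value of its output. Explicitly: - $\xi_0^\star$ is a possible steady-state value of $\xi_0$ in (C) if there exist $v_0^\star\in\mathbb{R}^p$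 and $u^\star\in\mathbb{R}^{n\times m}$ (rows $(u_i^\star)^T$) with $\xi_0^\star=A_0\xi_0^\star+B_0\mathsf{ave}(u^\star)$, $v_0^\star=C_0\xi_0^\star+D_0\mathsf{ave}(u^\star)$, and $u_i^\star=\phi_i(v_0^\star)$ for all $i$. - A steady state of (D) consists of values $(\xi_i^\star,v_i^\star,u_i^\star,\hat v_i^\star,\hat u_i^\star)_{i=1}^n$ with $\xi_i^\star=A_0\xi_i^\star+B_0\hat u_i^\star$, $v_i^\star=C_0\xi_i^\star+D_0\hat u_i^\star$, $u_i^\star=\phi_i(\hat v_i^\star)$ for all $i$, where $\hat u^\star$ and $\hat v^\star$ are the steady-state output values of $G_{\mathrm{con}}$ corresponding to the steady-state inputs $u^\star$ and $v^\star$, i.e. the limits of $G_{\mathrm{con}}u$ and $G_{\mathrm{con}}v$ for inputs $u,v$ converging to $u^\star,v^\star$. *)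

theory Defs
  imports "HOL-Analysis.Analysis"
begin

text \<open>
  A stack of \<open>n\<close> local vectors in \<open>R^r\<close>, i.e. an \<open>n \<times> r\<close> matrix whose \<open>i\<close>-th row is the
  vector of agent \<open>i\<close>, has type \<^typ>\<open>real^'r^'n\<close>; its \<open>i\<close>-th row is \<open>x $ i\<close>.  Index types are
  nonempty, so \<open>n \<ge> 1\<close> is implicit.
\<close>

definition ave :: "real^'r^'n \<Rightarrow> real^'r"
  where "ave x = (1 / real CARD('n)) *\<^sub>R (\<Sum>i\<in>UNIV. x $ i)"

definition avg_matrix :: "real^'n^'n"
  where "avg_matrix = (\<chi> i j. 1 / real CARD('n))"

lemma row_avg_matrix_mult:
  fixes x :: "real^'r^'n"
  shows "(avg_matrix ** x) $ i = ave x"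
  by (simp add: vec_eq_iff avg_matrix_def ave_def matrix_matrix_mult_def sum_distrib_left)

type_synonym ('r, 'n) dyn_system = "(nat \<Rightarrow> real^'r^'n) \<Rightarrow> (nat \<Rightarrow> real^'r^'n)"

definition average_consensus_tracking :: "('r::finite, 'n::finite) dyn_system \<Rightarrow> bool"
  where "average_consensus_tracking G \<longleftrightarrow>
    (\<forall>s s0. s \<longlonglongrightarrow> s0 \<longrightarrow> G s \<longlonglongrightarrow> avg_matrix ** s0)"

definition steady_response :: "('r::finite, 'n::finite) dyn_system \<Rightarrow> real^'r^'n \<Rightarrow> real^'r^'n \<Rightarrow> bool"
  where "steady_response G s0 y0 \<longleftrightarrow> (\<forall>s. s \<longlonglongrightarrow> s0 \<longrightarrow> G s \<longlonglongrightarrow> y0)"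

definition centralized_algorithm ::
  "real^'q^'q \<Rightarrow> real^'m^'q \<Rightarrow> real^'q^'p \<Rightarrow> real^'m^'p \<Rightarrow> ('n::finite \<Rightarrow> real^'p \<Rightarrow> real^'m) \<Rightarrow>
   (nat \<Rightarrow> real^'q) \<Rightarrow> (nat \<Rightarrow> real^'p) \<Rightarrow> (nat \<Rightarrow> real^'m^'n) \<Rightarrow> bool"
  where "centralized_algorithm A B C D \<phi> \<xi> v u \<longleftrightarrow>
    (\<forall>k. \<xi> (Suc k) = A *v \<xi> k + B *v ave (u k) \<and>
         v k = C *v \<xi> k + D *v ave (u k) \<and>
         (\<forall>i. u k $ i = \<phi> i (v k)))"

definition agent_equations ::
  "real^'q^'q \<Rightarrow> real^'m^'q \<Rightarrow> real^'q^'p \<Rightarrow> real^'m^'p \<Rightarrow> ('n::finite \<Rightarrow> real^'p \<Rightarrow> real^'m) \<Rightarrow>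
   (nat \<Rightarrow> real^'q^'n) \<Rightarrow> (nat \<Rightarrow> real^'p^'n) \<Rightarrow> (nat \<Rightarrow> real^'m^'n) \<Rightarrow>
   (nat \<Rightarrow> real^'p^'n) \<Rightarrow> (nat \<Rightarrow> real^'m^'n) \<Rightarrow> bool"
  where "agent_equations A B C D \<phi> \<xi> v u v\<^sub>h u\<^sub>h \<longleftrightarrow>
    (\<forall>k i. \<xi> (Suc k) $ i = A *v (\<xi> k $ i) + B *v (u\<^sub>h k $ i) \<and>
           v k $ i = C *v (\<xi> k $ i) + D *v (u\<^sub>h k $ i) \<and>
           u k $ i = \<phi> i (v\<^sub>h k $ i))"

text \<open>
  The consensus block acts on stacks of vectors of two different lengths.  As a term variable has
  a single type, the block is given by its instance \<open>G\<^sub>u\<close> on inputs \<open>u\<close> and its instance \<open>G\<^sub>v\<close> on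
  inputs \<open>v\<close>.
\<close>

definition decentralized_algorithm ::
  "real^'q^'q \<Rightarrow> real^'m^'q \<Rightarrow> real^'q^'p \<Rightarrow> real^'m^'p \<Rightarrow> ('n::finite \<Rightarrow> real^'p \<Rightarrow> real^'m) \<Rightarrow>
   ('m::finite, 'n::finite) dyn_system \<Rightarrow> ('p::finite, 'n) dyn_system \<Rightarrow>
   (nat \<Rightarrow> real^'q^'n) \<Rightarrow> (nat \<Rightarrow> real^'p^'n) \<Rightarrow> (nat \<Rightarrow> real^'m^'n) \<Rightarrow>
   (nat \<Rightarrow> real^'p^'n) \<Rightarrow> (nat \<Rightarrow> real^'m^'n) \<Rightarrow> bool"
  where "decentralized_algorithm A B C D \<phi> G\<^sub>u G\<^sub>v \<xi> v u v\<^sub>h u\<^sub>h \<longleftrightarrow>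
    agent_equations A B C D \<phi> \<xi> v u v\<^sub>h u\<^sub>h \<and> u\<^sub>h = G\<^sub>u u \<and> v\<^sub>h = G\<^sub>v v"

text \<open>
  A steady state satisfies the equations of the algorithm when every variable is held constant.
  The consensus blocks are the exception: their equations \<open>u\<^sub>h = G\<^sub>u u\<close> and \<open>v\<^sub>h = G\<^sub>v v\<close> are
  replaced by the relation between steady-state inputs and outputs, since a constant input need
  not produce a constant output.
\<close>

definition centralized_steady_state ::
  "real^'q^'q \<Rightarrow> real^'m^'q \<Rightarrow> real^'q^'p \<Rightarrow> real^'m^'p \<Rightarrow> ('n::finite \<Rightarrow> real^'p \<Rightarrow> real^'m) \<Rightarrow>
   real^'q \<Rightarrow> real^'p \<Rightarrow> real^'m^'n \<Rightarrow> bool"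
  where "centralized_steady_state A B C D \<phi> \<xi> v u \<longleftrightarrow>
    centralized_algorithm A B C D \<phi> (\<lambda>k. \<xi>) (\<lambda>k. v) (\<lambda>k. u)"

definition decentralized_steady_state ::
  "real^'q^'q \<Rightarrow> real^'m^'q \<Rightarrow> real^'q^'p \<Rightarrow> real^'m^'p \<Rightarrow> ('n::finite \<Rightarrow> real^'p \<Rightarrow> real^'m) \<Rightarrow>
   ('m::finite, 'n::finite) dyn_system \<Rightarrow> ('p::finite, 'n) dyn_system \<Rightarrow>
   real^'q^'n \<Rightarrow> real^'p^'n \<Rightarrow> real^'m^'n \<Rightarrow> real^'p^'n \<Rightarrow> real^'m^'n \<Rightarrow> bool"
  where "decentralized_steady_state A B C D \<phi> G\<^sub>u G\<^sub>v \<xi> v u v\<^sub>h u\<^sub>h \<longleftrightarrow>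
    agent_equations A B C D \<phi> (\<lambda>k. \<xi>) (\<lambda>k. v) (\<lambda>k. u) (\<lambda>k. v\<^sub>h) (\<lambda>k. u\<^sub>h) \<and>
    steady_response G\<^sub>u u u\<^sub>h \<and> steady_response G\<^sub>v v v\<^sub>h"

lemma centralized_steady_state_iff:
  "centralized_steady_state A B C D \<phi> \<xi> v u \<longleftrightarrow>
    \<xi> = A *v \<xi> + B *v ave u \<and> v = C *v \<xi> + D *v ave u \<and> (\<forall>i. u $ i = \<phi> i v)"
  by (simp add: centralized_steady_state_def centralized_algorithm_def)

lemma decentralized_steady_state_iff:
  "decentralized_steady_state A B C D \<phi> G\<^sub>u G\<^sub>v \<xi> v u v\<^sub>h u\<^sub>h \<longleftrightarrow>
    (\<forall>i. \<xi> $ i = A *v (\<xi> $ i) + B *v (u\<^sub>h $ i) \<and>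
         v $ i = C *v (\<xi> $ i) + D *v (u\<^sub>h $ i) \<and>
         u $ i = \<phi> i (v\<^sub>h $ i)) \<and>
    steady_response G\<^sub>u u u\<^sub>h \<and> steady_response G\<^sub>v v v\<^sub>h"
  by (simp add: decentralized_steady_state_def agent_equations_def)

end

theory Submission
  imports Defs
begin

text \<open>In steady state a consensus block is multiplication by J = \<open>avg_matrix\<close>,
  which replaces every row by the average. So each agent receives \<open>ave u\<close>, exactly the
  input of the centralized recursion, and can sit at the same state and output. The outputs then
  agree across agents, so averaging leaves them unchanged (\<open>ave_const_rows\<close>) and each
  \<open>\<phi> i\<close> is evaluated at the centralized output, returning the same
  \<open>u\<close>.\<close>

lemma steady_response_avg_matrix:
  assumes "average_consensus_tracking G"
  shows "steady_response G s (avg_matrix ** s)"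
  using assms by (simp add: average_consensus_tracking_def steady_response_def)

lemma ave_const_rows:
  "ave ((\<chi> i. x) :: real^'r^'n) = x"
  by (simp add: ave_def sum_constant_scaleR del: sum_constant)

theorem theorem3:
  fixes A\<^sub>0 :: "real^'q^'q" and B\<^sub>0 :: "real^'m^'q"
    and C\<^sub>0 :: "real^'q^'p" and D\<^sub>0 :: "real^'m^'p"
    and \<phi> :: "'n::finite \<Rightarrow> real^'p \<Rightarrow> real^'m"
    and G\<^sub>u :: "('m, 'n) dyn_system" and G\<^sub>v :: "('p, 'n) dyn_system"
    and \<xi>\<^sub>0 :: "real^'q"
  assumes "\<And>i. continuous_on UNIV (\<phi> i)"
    and "average_consensus_tracking G\<^sub>u"
    and "average_consensus_tracking G\<^sub>v"
    and "\<exists>v\<^sub>0 u. centralized_steady_state A\<^sub>0 B\<^sub>0 C\<^sub>0 D\<^sub>0 \<phi> \<xi>\<^sub>0 v\<^sub>0 u"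
  shows "\<exists>\<xi> v u v\<^sub>h u\<^sub>h.
    decentralized_steady_state A\<^sub>0 B\<^sub>0 C\<^sub>0 D\<^sub>0 \<phi> G\<^sub>u G\<^sub>v \<xi> v u v\<^sub>h u\<^sub>h \<and> (\<forall>i. \<xi> $ i = \<xi>\<^sub>0)"
proof -
  obtain v\<^sub>0 u where c: "\<xi>\<^sub>0 = A\<^sub>0 *v \<xi>\<^sub>0 + B\<^sub>0 *v ave u"
      "v\<^sub>0 = C\<^sub>0 *v \<xi>\<^sub>0 + D\<^sub>0 *v ave u" "\<And>i. u $ i = \<phi> i v\<^sub>0"
    using assms(4) by (auto simp: centralized_steady_state_iff)
  \<comment> \<open>Every agent gets a copy of the centralized state and output; \<open>u\<close> is
    kept, its rows may differ between agents.\<close>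
  define \<xi> :: "real^'q^'n" where "\<xi> = (\<chi> i. \<xi>\<^sub>0)"
  define v :: "real^'p^'n" where "v = (\<chi> i. v\<^sub>0)"
  have \<xi>: "\<xi> $ i = \<xi>\<^sub>0" and v: "v $ i = v\<^sub>0" for i
    by (simp_all add: \<xi>_def v_def)
  have ave_v: "ave v = v\<^sub>0"
    by (simp add: v_def ave_const_rows)
  have "decentralized_steady_state A\<^sub>0 B\<^sub>0 C\<^sub>0 D\<^sub>0 \<phi> G\<^sub>u G\<^sub>v \<xi> v u (avg_matrix ** v) (avg_matrix ** u)"
    \<comment> \<open>Row by row, \<open>avg_matrix ** u\<close> becomes \<open>ave u\<close> and
      \<open>avg_matrix ** v\<close> becomes \<open>v\<^sub>0\<close>, so the equations of each
      agent turn into the three facts \<open>c\<close>.\<close>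
    unfolding decentralized_steady_state_iff \<xi> v row_avg_matrix_mult ave_v
    using c steady_response_avg_matrix[OF assms(2)] steady_response_avg_matrix[OF assms(3)] by blast
  then show ?thesis
    using \<xi> by blast
qed

end
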